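(* Let $\lambda\in\mathbb R$ and let $\vec v\in\mathbb R^3$ be a unit vector. If $\Sigma$ is a $\lambda$-translating soliton with density vector $\vec v$ that is parametrized by a one-parameter family of circles contained in planes orthogonal to the density vector $\vec v$, then $\Sigma$ is a surface of revolution.
   Context: A $\lambda$-translating soliton with density vector $\vec v$ ($|\vec v|=1$) is an orientable surface in $\mathbb R^3$ whose mean curvature $H$ satisfies $2H=2\lambda+\langle N,\vec v\rangle$ at every point, where $N$ is the Gauss map and $2H$ is the sum of the principal curvatures, with the sign for which $\Delta X=2HN$. A surface parametrized by (foliated by) a one-parameter family of circles in parallel planes is one swept out by a smooth one-parameter family of circles, each contained in a different plane of a family of parallel planes. For planes orthogonal to $e_3=(0,0,1)$ it is a surface of the form $X(s,t)=(a(s),b(s),s)+r(s)(\cos t,\sin t,0)$, $s\in I$, $t\in\mathbb R$, with $a,b,r$ smooth and $r>0$. It is a surface of revolution (about an axis parallel to $e_3$) when the curve of centers is a straight line orthogonal to the planes, i.e. $a,b$ are constant. *)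

theory Defs
  imports "HOL-Analysis.Analysis"
begin

text \<open>Both definitions are meant for open \<open>S\<close>. In \<open>Ck_on\<close> all directional derivatives are
  required to be of class \<open>C^k\<close>, so in finite dimension this is the usual class \<open>C^(k+1)\<close>.\<close>

primrec Ck_on ::
  "nat \<Rightarrow> ('a::real_normed_vector \<Rightarrow> 'b::real_normed_vector) \<Rightarrow> 'a set \<Rightarrow> bool" where
  "Ck_on 0 f S \<longleftrightarrow> continuous_on S f"
| "Ck_on (Suc k) f S \<longleftrightarrow>
     (\<forall>x\<in>S. f differentiable (at x)) \<and>
     (\<forall>u. Ck_on k (\<lambda>x. frechet_derivative f (at x) u) S)"

definition smooth_on ::
  "('a::real_normed_vector \<Rightarrow> 'b::real_normed_vector) \<Rightarrow> 'a set \<Rightarrow> bool" where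
  "smooth_on f S \<longleftrightarrow> (\<forall>k. Ck_on k f S)"

text \<open>A surface is given by an immersion \<open>X\<close> of an open set \<open>D\<close> of the parameter plane. Tangent
  vectors are represented by their coordinates \<open>u :: real \<times> real\<close>.\<close>

definition immersed_surface :: "(real \<times> real \<Rightarrow> real^3) \<Rightarrow> (real \<times> real) set \<Rightarrow> bool" where
  "immersed_surface X D \<longleftrightarrow>
     open D \<and> smooth_on X D \<and> (\<forall>p\<in>D. inj (frechet_derivative X (at p)))"

definition gauss_map ::
  "(real \<times> real \<Rightarrow> real^3) \<Rightarrow> (real \<times> real) set \<Rightarrow> (real \<times> real \<Rightarrow> real^3) \<Rightarrow> bool" where
  "gauss_map X D N \<longleftrightarrow>
     continuous_on D N \<and>
     (\<forall>p\<in>D. norm (N p) = 1 \<and> (\<forall>u. N p \<bullet> frechet_derivative X (at p) u = 0))"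

definition first_form ::
  "(real \<times> real \<Rightarrow> real^3) \<Rightarrow> real \<times> real \<Rightarrow> real \<times> real \<Rightarrow> real \<times> real \<Rightarrow> real" where
  "first_form X p u w = frechet_derivative X (at p) u \<bullet> frechet_derivative X (at p) w"

text \<open>The coefficients of the second form are \<open>\<langle>N, X_ij\<rangle>\<close>; since \<open>\<langle>\<Delta>X, N\<rangle> = g^ij \<langle>X_ij, N\<rangle>\<close>, its
  trace with respect to the first form is the \<open>2H\<close> with \<open>\<Delta>X = 2HN\<close>.\<close>

definition second_form ::
  "(real \<times> real \<Rightarrow> real^3) \<Rightarrow> (real \<times> real \<Rightarrow> real^3) \<Rightarrow>
     real \<times> real \<Rightarrow> real \<times> real \<Rightarrow> real \<times> real \<Rightarrow> real" where
  "second_form X N p u w =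
     N p \<bullet> frechet_derivative (\<lambda>q. frechet_derivative X (at q) u) (at p) w"

text \<open>\<open>k1\<close> and \<open>k2\<close> are the normal curvatures in orthonormal directions diagonalizing the second
  form, that is, the eigenvalues (with multiplicity) of the shape operator.\<close>

definition principal_curvatures ::
  "(real \<times> real \<Rightarrow> real^3) \<Rightarrow> (real \<times> real \<Rightarrow> real^3) \<Rightarrow> real \<times> real \<Rightarrow> real \<Rightarrow> real \<Rightarrow> bool" where
  "principal_curvatures X N p k1 k2 \<longleftrightarrow>
     (\<exists>u1 u2.
        first_form X p u1 u1 = 1 \<and> first_form X p u2 u2 = 1 \<and> first_form X p u1 u2 = 0 \<and>
        second_form X N p u1 u1 = k1 \<and> second_form X N p u2 u2 = k2 \<and>
        second_form X N p u1 u2 = 0)"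

text \<open>For an immersed surface principal curvatures exist at every point and are unique up to
  order, so exactly one \<open>H\<close> satisfies the following.\<close>

definition has_mean_curvature ::
  "(real \<times> real \<Rightarrow> real^3) \<Rightarrow> (real \<times> real \<Rightarrow> real^3) \<Rightarrow> real \<times> real \<Rightarrow> real \<Rightarrow> bool" where
  "has_mean_curvature X N p H \<longleftrightarrow> (\<exists>k1 k2. principal_curvatures X N p k1 k2 \<and> 2 * H = k1 + k2)"

definition translating_soliton ::
  "real \<Rightarrow> real^3 \<Rightarrow> (real \<times> real \<Rightarrow> real^3) \<Rightarrow> (real \<times> real) set \<Rightarrow> bool" where
  "translating_soliton lam v X D \<longleftrightarrow>
     immersed_surface X D \<and>
     (\<exists>N. gauss_map X D N \<and>
        (\<forall>p\<in>D. \<exists>H. has_mean_curvature X N p H \<and> 2 * H = 2 * lam + N p \<bullet> v))"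

definition orthonormal_frame :: "real^3 \<Rightarrow> real^3 \<Rightarrow> real^3 \<Rightarrow> bool" where
  "orthonormal_frame e1 e2 e3 \<longleftrightarrow>
     norm e1 = 1 \<and> norm e2 = 1 \<and> norm e3 = 1 \<and> e1 \<bullet> e2 = 0 \<and> e1 \<bullet> e3 = 0 \<and> e2 \<bullet> e3 = 0"

definition center_curve ::
  "real^3 \<Rightarrow> real^3 \<Rightarrow> real^3 \<Rightarrow> (real \<Rightarrow> real) \<Rightarrow> (real \<Rightarrow> real) \<Rightarrow> real \<Rightarrow> real^3" where
  "center_curve e1 e2 e3 a b s = a s *\<^sub>R e1 + b s *\<^sub>R e2 + s *\<^sub>R e3"

text \<open>The parameter \<open>s\<close> is the height of the plane of the circle, and \<open>t\<close> runs over all of the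
  real line (the universal cover of the circle).\<close>

definition circle_surface ::
  "real^3 \<Rightarrow> real^3 \<Rightarrow> real^3 \<Rightarrow> (real \<Rightarrow> real) \<Rightarrow> (real \<Rightarrow> real) \<Rightarrow> (real \<Rightarrow> real) \<Rightarrow>
     real \<times> real \<Rightarrow> real^3" where
  "circle_surface e1 e2 e3 a b r = (\<lambda>(s, t).
     center_curve e1 e2 e3 a b s + r s *\<^sub>R (cos t *\<^sub>R e1 + sin t *\<^sub>R e2))"

definition circle_family ::
  "real set \<Rightarrow> (real \<Rightarrow> real) \<Rightarrow> (real \<Rightarrow> real) \<Rightarrow> (real \<Rightarrow> real) \<Rightarrow> bool" where
  "circle_family I a b r \<longleftrightarrow>
     open I \<and> is_interval I \<and> I \<noteq> {} \<and>
     smooth_on a I \<and> smooth_on b I \<and> smooth_on r I \<and> (\<forall>s\<in>I. r s > 0)"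

text \<open>The centers lie on a straight line orthogonal to the planes; equivalently, \<open>a\<close> and \<open>b\<close> are
  constant on \<open>I\<close> (lemma below).\<close>

definition circles_of_revolution ::
  "real set \<Rightarrow> real^3 \<Rightarrow> real^3 \<Rightarrow> real^3 \<Rightarrow> (real \<Rightarrow> real) \<Rightarrow> (real \<Rightarrow> real) \<Rightarrow> bool" where
  "circles_of_revolution I e1 e2 e3 a b \<longleftrightarrow>
     (\<exists>x. \<forall>s\<in>I. \<exists>h. center_curve e1 e2 e3 a b s = x + h *\<^sub>R e3)"

lemma circles_of_revolution_iff:
  assumes "orthonormal_frame e1 e2 e3"
  shows "circles_of_revolution I e1 e2 e3 a b \<longleftrightarrow> a constant_on I \<and> b constant_on I"
proof
  have o: "e1 \<bullet> e1 = 1" "e2 \<bullet> e2 = 1" "e1 \<bullet> e2 = 0" "e2 \<bullet> e1 = 0" "e3 \<bullet> e1 = 0" "e3 \<bullet> e2 = 0"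
    using assms by (auto simp: orthonormal_frame_def norm_eq_1 inner_commute)
  assume "circles_of_revolution I e1 e2 e3 a b"
  then obtain x where x: "\<And>s. s \<in> I \<Longrightarrow> \<exists>h. center_curve e1 e2 e3 a b s = x + h *\<^sub>R e3"
    by (auto simp: circles_of_revolution_def)
  have "a s = x \<bullet> e1 \<and> b s = x \<bullet> e2" if s: "s \<in> I" for s
  proof -
    obtain h where h: "center_curve e1 e2 e3 a b s = x + h *\<^sub>R e3"
      using x[OF s] by blast
    have "center_curve e1 e2 e3 a b s \<bullet> e1 = a s" "center_curve e1 e2 e3 a b s \<bullet> e2 = b s"
      by (simp_all add: center_curve_def inner_left_distrib o)
    then show ?thesis
      unfolding h by (simp add: inner_left_distrib o)
  qed
  then show "a constant_on I \<and> b constant_on I"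
    by (auto simp: constant_on_def)
next
  assume "a constant_on I \<and> b constant_on I"
  then obtain c d where "\<And>s. s \<in> I \<Longrightarrow> a s = c \<and> b s = d"
    by (auto simp: constant_on_def)
  then show "circles_of_revolution I e1 e2 e3 a b"
    unfolding circles_of_revolution_def center_curve_def
    by (intro exI[of _ "c *\<^sub>R e1 + d *\<^sub>R e2"]) auto
qed

end

theory Submission
  imports Defs
begin

text \<open>
  The proof takes place on a single circle. On the circle of height \<open>s\<close> let \<open>u = radial e1 e2 t\<close> be
  the outward unit vector at the point \<open>X (s, t)\<close>, and let \<open>\<alpha>\<close> and \<open>\<beta>\<close> be the components of \<open>X_s\<close>
  along \<open>u\<close> and along the unit tangent of the circle, so that \<open>\<alpha> = a' cos t + b' sin t + r'\<close>. The
  normal is \<open>N = \<plusminus>(\<alpha> v - u) / sqrt (1 + \<alpha>\<^sup>2)\<close>, and because \<open>v\<close> is orthogonal to the circles the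
  drift \<open>\<langle>N, v\<rangle>\<close> depends on \<open>\<alpha>\<close> alone, up to sign. With \<open>A = \<langle>X_ss, u\<rangle>\<close> the soliton equation, squared to remove
  both the square root and the choice of normal, reads (\<open>soliton_equation_on_circle\<close>)
  \<open>(r A - (1 + \<alpha>\<^sup>2 + \<beta>\<^sup>2) + r \<alpha> (1 + \<alpha>\<^sup>2))\<^sup>2 = 4 \<lambda>\<^sup>2 r\<^sup>2 (1 + \<alpha>\<^sup>2)\<^sup>3\<close>.

  Suppose that the velocity \<open>(a', b')\<close> of the centers is \<open>p (cos \<phi>, sin \<phi>)\<close> with \<open>p > 0\<close>. Then
  \<open>\<alpha> = r' + p cos (t - \<phi>)\<close> fills an interval, \<open>\<alpha>\<^sup>2 + \<beta>\<^sup>2\<close> is an affine function of \<open>\<alpha>\<close>, and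
  \<open>A\<close> is an affine function of \<open>\<alpha>\<close> plus a multiple of \<open>sin (t - \<phi>)\<close>. Averaging the equation over the
  two parameters \<open>\<phi> \<plusminus> \<tau>\<close>, which have the same \<open>\<alpha>\<close>, turns it into a polynomial identity in \<open>\<alpha>\<close>
  of the form
  \<open>m (1 + \<alpha>\<^sup>2)\<^sup>3 = (r \<alpha>\<^sup>3 + k\<^sub>1 \<alpha> + k\<^sub>0)\<^sup>2 + \<kappa> (p\<^sup>2 - (\<alpha> - r')\<^sup>2)\<close> with \<open>\<kappa> \<ge> 0\<close>.
  Its coefficients of degree 6 and 4 force \<open>m = r\<^sup>2\<close> and \<open>k\<^sub>1 = 3 r / 2\<close>, and then the one of degree 2
  says \<open>3 r\<^sup>2 = 9 r\<^sup>2 / 4 - \<kappa>\<close>, which is impossible (\<open>cubic_square_identity_impossible\<close>).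
  Hence \<open>a' = b' = 0\<close> at every height, that is, the centers do not move sideways.
\<close>

section \<open>The algebraic obstruction\<close>

text \<open>Comparison of coefficients; the identity is between polynomials, since it holds on a
  nondegenerate interval. The sign of \<open>\<kappa>\<close> matters only in degree 2.\<close>

lemma cubic_square_identity_impossible:
  fixes r m k0 k1 \<kappa> x0 p :: real
  assumes r: "r \<noteq> 0" and \<kappa>: "\<kappa> \<ge> 0" and p: "p > 0"
    and eq: "\<And>x. x \<in> {x0 - p..x0 + p} \<Longrightarrow>
      m * (1 + x\<^sup>2) ^ 3 = (r * x ^ 3 + k1 * x + k0)\<^sup>2 + \<kappa> * (p\<^sup>2 - (x - x0)\<^sup>2)"
  shows False
proof -
  define f where "f = [: m - k0\<^sup>2 - \<kappa> * (p\<^sup>2 - x0\<^sup>2), - 2 * k0 * k1 - 2 * \<kappa> * x0,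
    3 * m - k1\<^sup>2 + \<kappa>, - 2 * r * k0, 3 * m - 2 * r * k1, 0, m - r\<^sup>2 :]"
  have "poly f x = 0" if "x \<in> {x0 - p..x0 + p}" for x
    using eq[OF that] unfolding f_def by (simp add: algebra_simps power2_eq_square power3_eq_cube)
  then have "{x0 - p..x0 + p} \<subseteq> {x. poly f x = 0}"
    by blast
  moreover have "infinite {x0 - p..x0 + p}"
    using p by (simp add: infinite_Icc)
  ultimately have "f = 0"
    using poly_roots_finite[of f] finite_subset by blast
  then have c: "m = r\<^sup>2" "3 * m = 2 * r * k1" "3 * m - k1\<^sup>2 + \<kappa> = 0"
    by (auto simp: f_def)
  have "2 * k1 = 3 * r"
    using c r by (simp add: power2_eq_square)
  then have "4 * k1\<^sup>2 = 9 * r\<^sup>2"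
    by algebra
  then have "3 * r\<^sup>2 + 4 * \<kappa> = 0"
    using c(1,3) by linarith
  moreover have "r\<^sup>2 > 0"
    using r by simp
  ultimately show False
    using \<kappa> by linarith
qed

text \<open>The squared soliton equation on one circle, with the 2-jets of \<open>a\<close>, \<open>b\<close>, \<open>r\<close> as
  constants: \<open>(a1, b1)\<close> is the horizontal velocity of the center, and \<open>a2\<close>, \<open>b2\<close>, \<open>r2\<close> are the
  second derivatives.\<close>

lemma soliton_equation_forces_zero_velocity:
  fixes a1 b1 r1 a2 b2 r2 r lam :: real
  defines "\<alpha> \<equiv> \<lambda>t. a1 * cos t + b1 * sin t + r1"
    and "\<beta> \<equiv> \<lambda>t. b1 * cos t - a1 * sin t"
  assumes r: "r > 0"
    and eq: "\<And>t. (r * (a2 * cos t + b2 * sin t + r2) - (1 + (\<alpha> t)\<^sup>2 + (\<beta> t)\<^sup>2)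
                    + r * \<alpha> t * (1 + (\<alpha> t)\<^sup>2))\<^sup>2 = 4 * lam\<^sup>2 * r\<^sup>2 * (1 + (\<alpha> t)\<^sup>2) ^ 3"
  shows "a1 = 0 \<and> b1 = 0"
proof (rule ccontr)
  assume nz: "\<not> (a1 = 0 \<and> b1 = 0)"
  define p where "p = sqrt (a1\<^sup>2 + b1\<^sup>2)"
  have p2: "p\<^sup>2 = a1\<^sup>2 + b1\<^sup>2"
    by (simp add: p_def)
  have p: "p > 0"
    using nz by (auto simp: p_def sum_power2_gt_zero_iff)
  have "(a1 / p)\<^sup>2 + (b1 / p)\<^sup>2 = 1"
    using p by (simp add: power_divide p2[symmetric] flip: add_divide_distrib)
  then obtain \<phi> where \<phi>: "a1 / p = cos \<phi>" "b1 / p = sin \<phi>"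
    using sincos_total_2pi by metis
  have a1: "a1 = p * cos \<phi>" and b1: "b1 = p * sin \<phi>"
    using \<phi> p by (simp_all add: field_simps)
  define c1 c2 where "c1 = a2 * cos \<phi> + b2 * sin \<phi>" and "c2 = b2 * cos \<phi> - a2 * sin \<phi>"
  define k1 where "k1 = r * c1 / p - 2 * r1 + r"
  define k0 where "k0 = r * r2 - r * c1 * r1 / p - (1 + p\<^sup>2 - r1\<^sup>2)"
  \<comment> \<open>The angles \<open>\<tau>\<close> and \<open>- \<tau>\<close> to the direction of motion give the same \<open>x = \<alpha>\<close> and opposite
     values of \<open>\<sigma>\<close>; \<open>k1\<close> and \<open>k0\<close> collect the terms linear and constant in \<open>x\<close>.\<close>
  have circ: "(r * x ^ 3 + k1 * x + k0 + r * c2 * \<sigma>)\<^sup>2 = 4 * lam\<^sup>2 * r\<^sup>2 * (1 + x\<^sup>2) ^ 3"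
    if \<tau>: "x = r1 + p * cos \<tau>" "\<sigma> = sin \<tau>" for x \<sigma> \<tau>
  proof -
    have sc: "(sin \<phi>)\<^sup>2 + (cos \<phi>)\<^sup>2 = 1" "(sin \<tau>)\<^sup>2 + (cos \<tau>)\<^sup>2 = 1"
      by simp_all
    have \<alpha>: "\<alpha> (\<phi> + \<tau>) = x"
    proof -
      have "\<alpha> (\<phi> + \<tau>) = p * cos \<tau> * ((sin \<phi>)\<^sup>2 + (cos \<phi>)\<^sup>2) + r1"
        unfolding \<alpha>_def a1 b1 cos_add sin_add by algebra
      then show ?thesis
        using \<tau> by simp
    qed
    have "\<beta> (\<phi> + \<tau>) = - p * sin \<tau> * ((sin \<phi>)\<^sup>2 + (cos \<phi>)\<^sup>2)"
      unfolding \<beta>_def a1 b1 cos_add sin_add by algebra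
    then have "(\<beta> (\<phi> + \<tau>))\<^sup>2 = p\<^sup>2 * (sin \<tau>)\<^sup>2"
      by (simp add: power_mult_distrib)
    also have "\<dots> = p\<^sup>2 - (x - r1)\<^sup>2"
      using \<tau> by (simp add: sin_squared_eq power_mult_distrib algebra_simps)
    finally have \<beta>: "(\<beta> (\<phi> + \<tau>))\<^sup>2 = p\<^sup>2 - (x - r1)\<^sup>2" .
    have "a2 * cos (\<phi> + \<tau>) + b2 * sin (\<phi> + \<tau>) = c1 * cos \<tau> + c2 * \<sigma>"
      unfolding c1_def c2_def cos_add sin_add \<tau> by algebra
    moreover have "cos \<tau> = (x - r1) / p"
      using \<tau> p by simp
    ultimately have A: "a2 * cos (\<phi> + \<tau>) + b2 * sin (\<phi> + \<tau>) + r2 = c1 * (x - r1) / p + c2 * \<sigma> + r2"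
      by simp
    have "r * (c1 * (x - r1) / p + c2 * \<sigma> + r2) - (1 + x\<^sup>2 + (p\<^sup>2 - (x - r1)\<^sup>2)) + r * x * (1 + x\<^sup>2)
        = r * x ^ 3 + k1 * x + k0 + r * c2 * \<sigma>"
      using p unfolding k1_def k0_def
      by (simp add: field_simps power2_eq_square power3_eq_cube)
    then show ?thesis
      using eq[of "\<phi> + \<tau>"] unfolding \<alpha> \<beta> A by simp
  qed
  show False
  proof (rule cubic_square_identity_impossible)
    show "r \<noteq> 0"
      using r by simp
    show "(r * c2 / p)\<^sup>2 \<ge> 0"
      by simp
    show "p > 0"
      by (rule p)
    fix x assume "x \<in> {r1 - p..r1 + p}"
    then have bound: "- 1 \<le> (x - r1) / p" "(x - r1) / p \<le> 1"
      using p by (simp_all add: field_simps)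
    define \<tau> where "\<tau> = arccos ((x - r1) / p)"
    have x: "x = r1 + p * cos \<tau>"
      using bound p by (simp add: \<tau>_def cos_arccos)
    have plus: "(r * x ^ 3 + k1 * x + k0 + r * c2 * sin \<tau>)\<^sup>2 = 4 * lam\<^sup>2 * r\<^sup>2 * (1 + x\<^sup>2) ^ 3"
      by (rule circ[OF x refl])
    have minus: "(r * x ^ 3 + k1 * x + k0 + r * c2 * (- sin \<tau>))\<^sup>2 = 4 * lam\<^sup>2 * r\<^sup>2 * (1 + x\<^sup>2) ^ 3"
      by (rule circ[of _ "- \<tau>"]) (simp_all add: x)
    have avg: "M = q\<^sup>2 + y\<^sup>2" if "(q + y)\<^sup>2 = M" "(q - y)\<^sup>2 = M" for q y M :: real
      using that unfolding power2_sum power2_diff by linarith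
    have "(r * c2 / p)\<^sup>2 * (p\<^sup>2 - (x - r1)\<^sup>2) = (r * c2 * sin \<tau>)\<^sup>2"
      using p unfolding x by (simp add: power_mult_distrib power_divide sin_squared_eq field_simps)
    then show "4 * lam\<^sup>2 * r\<^sup>2 * (1 + x\<^sup>2) ^ 3
        = (r * x ^ 3 + k1 * x + k0)\<^sup>2 + (r * c2 / p)\<^sup>2 * (p\<^sup>2 - (x - r1)\<^sup>2)"
      using avg[of "r * x ^ 3 + k1 * x + k0" "r * c2 * sin \<tau>", OF plus] minus by simp
  qed
qed

section \<open>Traces and orthonormal frames\<close>

text \<open>The classical formula for \<open>2H\<close> from the coefficients of the two forms. If \<open>d\<close> is the
  determinant of the matrix whose columns are the orthonormal vectors \<open>u1 = (x1, y1)\<close> and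
  \<open>u2 = (x2, y2)\<close>, then \<open>x1 u2 - x2 u1 = (0, d)\<close> and \<open>y2 u1 - y1 u2 = (d, 0)\<close>, so evaluating the
  first form gives \<open>x1\<^sup>2 + x2\<^sup>2 = G d\<^sup>2\<close> and so on, while \<open>(E G - F\<^sup>2) d\<^sup>2 = 1\<close>.\<close>

lemma trace_in_orthonormal_basis:
  fixes E F G l m n x1 y1 x2 y2 :: real
  assumes 1: "E * x1\<^sup>2 + 2 * F * x1 * y1 + G * y1\<^sup>2 = 1"
    and 2: "E * x2\<^sup>2 + 2 * F * x2 * y2 + G * y2\<^sup>2 = 1"
    and 12: "E * x1 * x2 + F * (x1 * y2 + y1 * x2) + G * y1 * y2 = 0"
  shows "(E * G - F\<^sup>2) * ((l * x1\<^sup>2 + 2 * m * x1 * y1 + n * y1\<^sup>2) + (l * x2\<^sup>2 + 2 * m * x2 * y2 + n * y2\<^sup>2))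
           = l * G - 2 * m * F + n * E"
proof -
  define d where "d = x1 * y2 - x2 * y1"
  have det: "(E * G - F\<^sup>2) * d\<^sup>2 = 1"
    unfolding d_def using 1 2 12 by algebra
  have xx: "x1\<^sup>2 + x2\<^sup>2 = G * d\<^sup>2"
    unfolding d_def using 1 2 12 by algebra
  have yy: "y1\<^sup>2 + y2\<^sup>2 = E * d\<^sup>2"
    unfolding d_def using 1 2 12 by algebra
  have xy: "x1 * y1 + x2 * y2 = - F * d\<^sup>2"
    unfolding d_def using 1 2 12 by algebra
  have "(l * x1\<^sup>2 + 2 * m * x1 * y1 + n * y1\<^sup>2) + (l * x2\<^sup>2 + 2 * m * x2 * y2 + n * y2\<^sup>2)
      = l * (x1\<^sup>2 + x2\<^sup>2) + 2 * m * (x1 * y1 + x2 * y2) + n * (y1\<^sup>2 + y2\<^sup>2)"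
    by algebra
  also have "\<dots> = (l * G - 2 * m * F + n * E) * d\<^sup>2"
    unfolding xx yy xy by algebra
  finally show ?thesis
    using det by (simp add: mult.commute mult.left_commute)
qed

lemma orthonormal_frame_inner:
  assumes "orthonormal_frame e1 e2 e3"
  shows "e1 \<bullet> e1 = 1" "e2 \<bullet> e2 = 1" "e3 \<bullet> e3 = 1"
    "e1 \<bullet> e2 = 0" "e2 \<bullet> e1 = 0" "e1 \<bullet> e3 = 0" "e3 \<bullet> e1 = 0" "e2 \<bullet> e3 = 0" "e3 \<bullet> e2 = 0"
  using assms by (auto simp: orthonormal_frame_def norm_eq_1 inner_commute)

lemma orthonormal_frame_Parseval:
  assumes fr: "orthonormal_frame e1 e2 e3"
  shows "(x \<bullet> e1)\<^sup>2 + (x \<bullet> e2)\<^sup>2 + (x \<bullet> e3)\<^sup>2 = (norm x)\<^sup>2"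
proof -
  note o = orthonormal_frame_inner[OF fr]
  define y where "y = x - (x \<bullet> e1) *\<^sub>R e1 - (x \<bullet> e2) *\<^sub>R e2 - (x \<bullet> e3) *\<^sub>R e3"
  have ne: "e1 \<noteq> e2" "e1 \<noteq> e3" "e2 \<noteq> e3" "e1 \<noteq> 0" "e2 \<noteq> 0" "e3 \<noteq> 0"
    using o by auto
  have "independent {e1, e2, e3}"
    by (rule pairwise_orthogonal_independent)
      (use o ne in \<open>auto simp: pairwise_def orthogonal_def\<close>)
  moreover have "card {e1, e2, e3} = 3"
    using ne by simp
  ultimately have "span {e1, e2, e3} = UNIV"
    using card_ge_dim_independent[of "{e1, e2, e3}" UNIV] by auto
  moreover have "orthogonal y z" if "z \<in> {e1, e2, e3}" for z
    using that o by (auto simp: y_def orthogonal_def inner_diff_left)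
  ultimately have "orthogonal y y"
    using orthogonal_to_span by blast
  then have "y = 0"
    by (simp add: orthogonal_def)
  then have x: "x = (x \<bullet> e1) *\<^sub>R e1 + (x \<bullet> e2) *\<^sub>R e2 + (x \<bullet> e3) *\<^sub>R e3"
    by (simp add: y_def algebra_simps)
  have "(norm x)\<^sup>2 = x \<bullet> ((x \<bullet> e1) *\<^sub>R e1 + (x \<bullet> e2) *\<^sub>R e2 + (x \<bullet> e3) *\<^sub>R e3)"
    using x by (simp add: power2_norm_eq_inner)
  then show ?thesis
    by (simp add: inner_right_distrib power2_eq_square)
qed

section \<open>The derivatives of the surface\<close>

definition radial :: "real^3 \<Rightarrow> real^3 \<Rightarrow> real \<Rightarrow> real^3" where
  "radial e1 e2 t = cos t *\<^sub>R e1 + sin t *\<^sub>R e2"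

definition tangential :: "real^3 \<Rightarrow> real^3 \<Rightarrow> real \<Rightarrow> real^3" where
  "tangential e1 e2 t = cos t *\<^sub>R e2 - sin t *\<^sub>R e1"

lemma orthonormal_frame_radial_tangential:
  assumes fr: "orthonormal_frame e1 e2 e3"
  shows "orthonormal_frame (radial e1 e2 t) (tangential e1 e2 t) e3"
  using sin_cos_squared_add[of t]
  by (simp add: orthonormal_frame_def norm_eq_1 radial_def tangential_def inner_left_distrib
      inner_right_distrib inner_diff_left inner_diff_right orthonormal_frame_inner[OF fr]
      power2_eq_square algebra_simps)

lemma frame_in_radial_tangential:
  "e1 = cos t *\<^sub>R radial e1 e2 t - sin t *\<^sub>R tangential e1 e2 t"
  "e2 = sin t *\<^sub>R radial e1 e2 t + cos t *\<^sub>R tangential e1 e2 t"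
proof -
  have "cos t *\<^sub>R radial e1 e2 t - sin t *\<^sub>R tangential e1 e2 t = ((sin t)\<^sup>2 + (cos t)\<^sup>2) *\<^sub>R e1"
    by (simp add: radial_def tangential_def power2_eq_square algebra_simps del: sin_cos_squared_add sin_cos_squared_add2 sin_cos_squared_add3)
  then show "e1 = cos t *\<^sub>R radial e1 e2 t - sin t *\<^sub>R tangential e1 e2 t"
    by simp
  have "sin t *\<^sub>R radial e1 e2 t + cos t *\<^sub>R tangential e1 e2 t = ((sin t)\<^sup>2 + (cos t)\<^sup>2) *\<^sub>R e2"
    by (simp add: radial_def tangential_def power2_eq_square algebra_simps del: sin_cos_squared_add sin_cos_squared_add2 sin_cos_squared_add3)
  then show "e2 = sin t *\<^sub>R radial e1 e2 t + cos t *\<^sub>R tangential e1 e2 t"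
    by simp
qed

lemma has_derivative_radial:
  "((\<lambda>q. radial e1 e2 (snd q)) has_derivative (\<lambda>w. snd w *\<^sub>R tangential e1 e2 t)) (at (s::real, t))"
  unfolding radial_def tangential_def
  by (auto intro!: derivative_eq_intros simp: fun_eq_iff algebra_simps)

lemma has_derivative_tangential:
  "((\<lambda>q. tangential e1 e2 (snd q)) has_derivative (\<lambda>w. - snd w *\<^sub>R radial e1 e2 t)) (at (s::real, t))"
  unfolding radial_def tangential_def
  by (auto intro!: derivative_eq_intros simp: fun_eq_iff algebra_simps)

lemma has_derivative_comp_fst:
  fixes f :: "real \<Rightarrow> real"
  assumes "(f has_real_derivative f') (at s)"
  shows "((\<lambda>q. f (fst q)) has_derivative (\<lambda>w. fst w * f')) (at (s, t::real))"
proof -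
  have "(f has_derivative (\<lambda>h. h * f')) (at (fst (s, t)))"
    using assms by (simp add: has_field_derivative_def mult_commute_abs)
  then show ?thesis
    using has_derivative_compose[OF has_derivative_fst[OF has_derivative_ident]] by auto
qed

lemma smooth_on_imp_two_derivatives:
  fixes f :: "real \<Rightarrow> real"
  assumes "smooth_on f I"
  obtains f' f'' where "\<And>s. s \<in> I \<Longrightarrow> (f has_real_derivative f' s) (at s)"
    and "\<And>s. s \<in> I \<Longrightarrow> (f' has_real_derivative f'' s) (at s)"
proof
  have C2: "Ck_on (Suc (Suc 0)) f I"
    using assms unfolding smooth_on_def by blast
  have real: "(g has_real_derivative frechet_derivative g (at s) 1) (at s)"
    if "g differentiable (at s)" for g :: "real \<Rightarrow> real" and s
  proof -
    have d: "(g has_derivative frechet_derivative g (at s)) (at s)"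
      using that frechet_derivative_works by blast
    have "frechet_derivative g (at s) h = frechet_derivative g (at s) 1 * h" for h
      using linear_cmul[OF has_derivative_linear[OF d], of h 1] by simp
    then have "frechet_derivative g (at s) = (*) (frechet_derivative g (at s) 1)"
      by (rule ext)
    then show ?thesis
      using d by (metis has_field_derivative_def)
  qed
  show "(f has_real_derivative frechet_derivative f (at s) 1) (at s)" if "s \<in> I" for s
    using C2 that by (intro real) simp
  show "((\<lambda>s. frechet_derivative f (at s) 1) has_real_derivative
      frechet_derivative (\<lambda>s. frechet_derivative f (at s) 1) (at s) 1) (at s)" if "s \<in> I" for s
    using C2 that by (intro real) simp
qed

text \<open>The term \<open>h X_s + k X_t\<close>, as a function of \<open>q = (s, t)\<close> for fixed \<open>(h, k) = u\<close>, is what has to be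
  differentiated again for the second form.\<close>

lemma circle_surface_frechet_derivative:
  assumes "(a has_real_derivative a') (at s)" "(b has_real_derivative b') (at s)"
    "(r has_real_derivative r') (at s)"
  shows "frechet_derivative (circle_surface e1 e2 e3 a b r) (at (s, t)) u =
    fst u *\<^sub>R (a' *\<^sub>R e1 + b' *\<^sub>R e2 + e3 + r' *\<^sub>R radial e1 e2 t) + snd u *\<^sub>R r s *\<^sub>R tangential e1 e2 t"
proof -
  have X: "circle_surface e1 e2 e3 a b r = (\<lambda>q. a (fst q) *\<^sub>R e1 + b (fst q) *\<^sub>R e2 + fst q *\<^sub>R e3
      + r (fst q) *\<^sub>R radial e1 e2 (snd q))"
    by (auto simp: circle_surface_def center_curve_def radial_def fun_eq_iff)
  have "(circle_surface e1 e2 e3 a b r has_derivative (\<lambda>u.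
      fst u *\<^sub>R (a' *\<^sub>R e1 + b' *\<^sub>R e2 + e3 + r' *\<^sub>R radial e1 e2 t)
      + snd u *\<^sub>R r s *\<^sub>R tangential e1 e2 t)) (at (s, t))"
    unfolding X
    by (rule derivative_eq_intros has_derivative_comp_fst[OF assms(1)]
        has_derivative_comp_fst[OF assms(2)] has_derivative_comp_fst[OF assms(3)]
        has_derivative_radial refl)+
      (simp add: fun_eq_iff algebra_simps)
  then show ?thesis
    by (simp add: frechet_derivative_at[symmetric])
qed

lemma circle_surface_second_frechet_derivative:
  assumes I: "open I" "s \<in> I"
    and a: "\<And>s. s \<in> I \<Longrightarrow> (a has_real_derivative a' s) (at s)" "(a' has_real_derivative a'') (at s)"
    and b: "\<And>s. s \<in> I \<Longrightarrow> (b has_real_derivative b' s) (at s)" "(b' has_real_derivative b'') (at s)"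
    and r: "\<And>s. s \<in> I \<Longrightarrow> (r has_real_derivative r' s) (at s)" "(r' has_real_derivative r'') (at s)"
  shows "frechet_derivative (\<lambda>q. frechet_derivative (circle_surface e1 e2 e3 a b r) (at q) u) (at (s, t)) w =
    (fst u * fst w) *\<^sub>R (a'' *\<^sub>R e1 + b'' *\<^sub>R e2 + r'' *\<^sub>R radial e1 e2 t)
    + (fst u * snd w + snd u * fst w) *\<^sub>R r' s *\<^sub>R tangential e1 e2 t
    - (snd u * snd w) *\<^sub>R r s *\<^sub>R radial e1 e2 t"
proof -
  define V where "V = (\<lambda>q. fst u *\<^sub>R (a' (fst q) *\<^sub>R e1 + b' (fst q) *\<^sub>R e2 + e3
      + r' (fst q) *\<^sub>R radial e1 e2 (snd q)) + snd u *\<^sub>R r (fst q) *\<^sub>R tangential e1 e2 (snd q))"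
  define W where "W = (\<lambda>w. (fst u * fst w) *\<^sub>R (a'' *\<^sub>R e1 + b'' *\<^sub>R e2 + r'' *\<^sub>R radial e1 e2 t)
    + (fst u * snd w + snd u * fst w) *\<^sub>R r' s *\<^sub>R tangential e1 e2 t
    - (snd u * snd w) *\<^sub>R r s *\<^sub>R radial e1 e2 t)"
  have "(V has_derivative W) (at (s, t))"
    unfolding V_def W_def
    by (rule derivative_eq_intros has_derivative_comp_fst[OF a(2)] has_derivative_comp_fst[OF b(2)]
        has_derivative_comp_fst[OF r(1)[OF I(2)]] has_derivative_comp_fst[OF r(2)]
        has_derivative_radial has_derivative_tangential refl)+
      (simp add: fun_eq_iff algebra_simps)
  then have "((\<lambda>q. frechet_derivative (circle_surface e1 e2 e3 a b r) (at q) u) has_derivative W) (at (s, t))"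
  proof (rule has_derivative_transform_within_open)
    show "open (I \<times> (UNIV :: real set))"
      using I by (simp add: open_Times)
    show "(s, t) \<in> I \<times> UNIV"
      using I by simp
    fix q :: "real \<times> real" assume "q \<in> I \<times> UNIV"
    then have "fst q \<in> I" by auto
    then show "V q = frechet_derivative (circle_surface e1 e2 e3 a b r) (at q) u"
      using circle_surface_frechet_derivative[OF a(1) b(1) r(1), of "fst q" e1 e2 e3 "snd q" u]
      by (simp add: V_def)
  qed
  then show ?thesis
    by (simp add: frechet_derivative_at[symmetric] W_def)
qed

section \<open>The soliton equation on one circle\<close>

text \<open>In the frame formed by the radial, the tangential and the density vector the normal has
  components \<open>(n, 0, - \<alpha> n)\<close> with \<open>n\<^sup>2 (1 + \<alpha>\<^sup>2) = 1\<close>. The second form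
  is \<open>n\<close> times an expression in the 2-jets, so the soliton equation is affine in \<open>n\<close>; solving it for
  the terms with \<open>n\<close> and squaring eliminates \<open>n\<close>.\<close>

lemma soliton_equation_on_circle:
  fixes r :: "real \<Rightarrow> real"
  assumes fr: "orthonormal_frame e1 e2 v"
    and I: "open I" "s \<in> I" and pos: "r s > 0"
    and a: "\<And>s. s \<in> I \<Longrightarrow> (a has_real_derivative a' s) (at s)" "(a' has_real_derivative a'') (at s)"
    and b: "\<And>s. s \<in> I \<Longrightarrow> (b has_real_derivative b' s) (at s)" "(b' has_real_derivative b'') (at s)"
    and r: "\<And>s. s \<in> I \<Longrightarrow> (r has_real_derivative r' s) (at s)" "(r' has_real_derivative r'') (at s)"
    and sol: "translating_soliton lam v (circle_surface e1 e2 v a b r) (I \<times> UNIV)"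
  defines "\<alpha> \<equiv> \<lambda>t. a' s * cos t + b' s * sin t + r' s"
    and "\<beta> \<equiv> \<lambda>t. b' s * cos t - a' s * sin t"
  shows "(r s * (a'' * cos t + b'' * sin t + r'') - (1 + (\<alpha> t)\<^sup>2 + (\<beta> t)\<^sup>2)
      + r s * \<alpha> t * (1 + (\<alpha> t)\<^sup>2))\<^sup>2 = 4 * lam\<^sup>2 * (r s)\<^sup>2 * (1 + (\<alpha> t)\<^sup>2) ^ 3"
proof -
  let ?X = "circle_surface e1 e2 v a b r"
  let ?R = "radial e1 e2 t" and ?T = "tangential e1 e2 t"
  define A where "A = a'' * cos t + b'' * sin t + r''"
  define B where "B = b'' * cos t - a'' * sin t"
  note fr' = orthonormal_frame_radial_tangential[OF fr, of t]
  note o = orthonormal_frame_inner[OF fr']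
  have D1: "frechet_derivative ?X (at (s, t)) u =
      fst u *\<^sub>R (\<alpha> t *\<^sub>R ?R + \<beta> t *\<^sub>R ?T + v) + snd u *\<^sub>R r s *\<^sub>R ?T" for u
  proof -
    have "a' s *\<^sub>R e1 + b' s *\<^sub>R e2 + v + r' s *\<^sub>R ?R = \<alpha> t *\<^sub>R ?R + \<beta> t *\<^sub>R ?T + v"
      by (subst (1) frame_in_radial_tangential(1)[of e1 t e2],
          subst (2) frame_in_radial_tangential(2)[of e2 t e1])
        (simp add: \<alpha>_def \<beta>_def algebra_simps)
    then show ?thesis
      using circle_surface_frechet_derivative[OF a(1) b(1) r(1), OF I(2) I(2) I(2), of e1 e2 v t u]
      by simp
  qed
  have D2: "frechet_derivative (\<lambda>q. frechet_derivative ?X (at q) u) (at (s, t)) w =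
      (fst u * fst w) *\<^sub>R (A *\<^sub>R ?R + B *\<^sub>R ?T)
      + (fst u * snd w + snd u * fst w) *\<^sub>R r' s *\<^sub>R ?T - (snd u * snd w) *\<^sub>R r s *\<^sub>R ?R" for u w
  proof -
    have "a'' *\<^sub>R e1 + b'' *\<^sub>R e2 + r'' *\<^sub>R ?R = A *\<^sub>R ?R + B *\<^sub>R ?T"
      by (subst (1) frame_in_radial_tangential(1)[of e1 t e2],
          subst (2) frame_in_radial_tangential(2)[of e2 t e1])
        (simp add: A_def B_def algebra_simps)
    then show ?thesis
      using circle_surface_second_frechet_derivative[OF I a b r, of e1 e2 v u t w] by simp
  qed
  obtain N H where N: "gauss_map ?X (I \<times> UNIV) N"
    and H: "has_mean_curvature ?X N (s, t) H" "2 * H = 2 * lam + N (s, t) \<bullet> v"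
    using sol I unfolding translating_soliton_def by blast
  define n where "n = N (s, t) \<bullet> ?R"
  have perp: "N (s, t) \<bullet> frechet_derivative ?X (at (s, t)) u = 0" for u
    using N I(2) unfolding gauss_map_def by blast
  have unit: "norm (N (s, t)) = 1"
    using N I unfolding gauss_map_def by auto
  have nT: "N (s, t) \<bullet> ?T = 0"
    using perp[of "(0, 1)"] pos by (simp add: D1)
  have nv: "N (s, t) \<bullet> v = - \<alpha> t * n"
    using perp[of "(1, 0)"] nT by (simp add: D1 inner_right_distrib n_def)
  have n2: "n\<^sup>2 * (1 + (\<alpha> t)\<^sup>2) = 1"
    using orthonormal_frame_Parseval[OF fr', of "N (s, t)"] nT nv unit
    by (simp add: n_def power_mult_distrib algebra_simps)

  have first: "first_form ?X (s, t) u w = ((\<alpha> t)\<^sup>2 + (\<beta> t)\<^sup>2 + 1) * (fst u * fst w)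
      + (r s * \<beta> t) * (fst u * snd w + snd u * fst w) + (r s)\<^sup>2 * (snd u * snd w)" for u w
    by (simp add: first_form_def D1 inner_left_distrib inner_right_distrib o power2_eq_square
        algebra_simps)
  have second: "second_form ?X N (s, t) u w = (n * A) * (fst u * fst w) - (n * r s) * (snd u * snd w)"
    for u w
    by (simp add: second_form_def D2 inner_right_distrib inner_diff_right nT n_def[symmetric]
        algebra_simps)
  obtain u1 u2 where u: "first_form ?X (s, t) u1 u1 = 1" "first_form ?X (s, t) u2 u2 = 1"
      "first_form ?X (s, t) u1 u2 = 0"
    and k: "2 * H = second_form ?X N (s, t) u1 u1 + second_form ?X N (s, t) u2 u2"
    using H(1) unfolding has_mean_curvature_def principal_curvatures_def by auto
  have "(((\<alpha> t)\<^sup>2 + (\<beta> t)\<^sup>2 + 1) * (r s)\<^sup>2 - (r s * \<beta> t)\<^sup>2) * (2 * H)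
      = (n * A) * (r s)\<^sup>2 - 2 * 0 * (r s * \<beta> t) + (- n * r s) * ((\<alpha> t)\<^sup>2 + (\<beta> t)\<^sup>2 + 1)"
    unfolding k second
    using trace_in_orthonormal_basis[of "(\<alpha> t)\<^sup>2 + (\<beta> t)\<^sup>2 + 1" "fst u1" "r s * \<beta> t" "snd u1" "(r s)\<^sup>2"
        "fst u2" "snd u2" "n * A" 0 "- n * r s"] u
    by (simp add: first power2_eq_square algebra_simps)
  then have "r s * ((1 + (\<alpha> t)\<^sup>2) * r s * (2 * H)) = r s * (n * (r s * A - (1 + (\<alpha> t)\<^sup>2 + (\<beta> t)\<^sup>2)))"
    by (simp add: power2_eq_square algebra_simps)
  then have "(1 + (\<alpha> t)\<^sup>2) * r s * (2 * lam - \<alpha> t * n) = n * (r s * A - (1 + (\<alpha> t)\<^sup>2 + (\<beta> t)\<^sup>2))"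
    using pos H(2) nv by simp
  then have "n * (r s * A - (1 + (\<alpha> t)\<^sup>2 + (\<beta> t)\<^sup>2) + r s * \<alpha> t * (1 + (\<alpha> t)\<^sup>2))
      = 2 * lam * r s * (1 + (\<alpha> t)\<^sup>2)"
    by algebra
  then show ?thesis
    unfolding A_def[symmetric] using n2 by algebra
qed

section \<open>Surfaces foliated by circles orthogonal to the density vector\<close>

theorem theorem5p1:
  fixes lam :: real and v e1 e2 :: "real^3"
    and I :: "real set" and a b r :: "real \<Rightarrow> real"
  assumes "norm v = 1"
    and "orthonormal_frame e1 e2 v"
    and "circle_family I a b r"
    and "translating_soliton lam v (circle_surface e1 e2 v a b r) (I \<times> UNIV)"
  shows "circles_of_revolution I e1 e2 v a b"
proof -
  have I: "open I" "is_interval I" and pos: "\<And>s. s \<in> I \<Longrightarrow> r s > 0"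
    and sm: "smooth_on a I" "smooth_on b I" "smooth_on r I"
    using assms(3) by (auto simp: circle_family_def)
  obtain a' a'' where a: "\<And>s. s \<in> I \<Longrightarrow> (a has_real_derivative a' s) (at s)"
      "\<And>s. s \<in> I \<Longrightarrow> (a' has_real_derivative a'' s) (at s)"
    using smooth_on_imp_two_derivatives[OF sm(1)] by metis
  obtain b' b'' where b: "\<And>s. s \<in> I \<Longrightarrow> (b has_real_derivative b' s) (at s)"
      "\<And>s. s \<in> I \<Longrightarrow> (b' has_real_derivative b'' s) (at s)"
    using smooth_on_imp_two_derivatives[OF sm(2)] by metis
  obtain r' r'' where r: "\<And>s. s \<in> I \<Longrightarrow> (r has_real_derivative r' s) (at s)"
      "\<And>s. s \<in> I \<Longrightarrow> (r' has_real_derivative r'' s) (at s)"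
    using smooth_on_imp_two_derivatives[OF sm(3)] by metis
  have zero: "a' s = 0 \<and> b' s = 0" if s: "s \<in> I" for s
    using soliton_equation_forces_zero_velocity[OF pos[OF s]
        soliton_equation_on_circle[OF assms(2) I(1) s pos[OF s] a(1) a(2)[OF s] b(1) b(2)[OF s]
          r(1) r(2)[OF s] assms(4)]]
    by blast
  have const: "f constant_on I" if "\<And>s. s \<in> I \<Longrightarrow> (f has_real_derivative 0) (at s)"
    for f :: "real \<Rightarrow> real"
  proof -
    have "\<exists>c. \<forall>s\<in>I. f s = c"
      using that I(2)
      by (intro has_field_derivative_zero_constant)
        (auto simp: is_interval_convex_1 intro: has_field_derivative_at_within)
    then show ?thesis
      by (simp add: constant_on_def)
  qed
  have "a constant_on I" "b constant_on I"
    using const a(1) b(1) zero by metis+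
  then show ?thesis
    by (simp add: circles_of_revolution_iff[OF assms(2)])
qed

end
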